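(* Let $f$ and $m$ be positive integers such that $f$ is not a multiple of $m$ and $m\le f+1$. Then the set $\mathcal A\mathrm{MED}(f,m)$ is a ratio-covariety whose minimal element with respect to inclusion is $\Delta(f,m)=\langle m\rangle\cup\{0,f+1,f+2,\dots\}$.
   Context: $\mathbb N=\{0,1,2,\dots\}$. A numerical semigroup is a submonoid $S$ of $(\mathbb N,+)$ with finite complement; $\operatorname{Fb}(S)=\max(\mathbb N\setminus S)$ is its Frobenius number ($-1$ if $S=\mathbb N$), $\operatorname{m}(S)=\min(S\setminus\{0\})$ its multiplicity, $\operatorname{e}(S)$ its embedding dimension (the cardinality of its unique minimal generating set), and $\operatorname{r}(S)=\min(S\setminus\langle\operatorname{m}(S)\rangle)$ its ratio, where $\langle m\rangle=\{\lambda m\mid\lambda\in\mathbb N\}$. $S$ is an $\mathcal A$-semigroup if there is no $s$ with $s,s+1\in S$ and $s,s+1<\operatorname{Fb}(S)$. $S$ is a MED-semigroup if $\operatorname{e}(S)=\operatorname{m}(S)$. An $\mathcal A\mathrm{MED}$-semigroup is a numerical semigroup that is both an $\mathcal A$-semigroup and a MED-semigroup; $\mathcal A\mathrm{MED}(f,m)$ is the set of all $\mathcal A\mathrm{MED}$-semigroups with Frobenius number $f$ and multiplicity $m$. A ratio-covariety (of numerical semigroups) is a non-empty family $\mathcal R$ of numerical semigroups such that: (i) $\mathcal R$ has a minimum element with respect to inclusion, denoted $\min_\subseteq\mathcal R$; (ii) if $S,T\in\mathcal R$ then $S\cap T\in\mathcal R$; (iii) if $S\in\mathcal R\setminus\{\min_\subseteq\mathcal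 R\}$ then $S\setminus\{\operatorname{r}(S)\}\in\mathcal R$. *)

theory Defs
  imports Complex_Main
begin

definition add_submonoid :: "nat set \<Rightarrow> bool" where
  "add_submonoid S \<longleftrightarrow> 0 \<in> S \<and> (\<forall>x\<in>S. \<forall>y\<in>S. x + y \<in> S)"

definition numerical_semigroup :: "nat set \<Rightarrow> bool" where
  "numerical_semigroup S \<longleftrightarrow> add_submonoid S \<and> finite (UNIV - S)"

definition multiples :: "nat \<Rightarrow> nat set" where
  "multiples m = {k * m | k. True}"

definition frobenius :: "nat set \<Rightarrow> int" where
  "frobenius S = (if S = UNIV then -1 else int (Max (UNIV - S)))"

definition multiplicity :: "nat set \<Rightarrow> nat" where
  "multiplicity S = Inf (S - {0})"

text \<open>The infimum of a nonempty set of naturals is its minimum. The set below is empty exactly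
  when \<open>S = UNIV\<close> (among numerical semigroups), where the ratio does not exist and
  \<open>ratio S\<close> has the value 0.\<close>

definition ratio :: "nat set \<Rightarrow> nat" where
  "ratio S = Inf (S - multiples (multiplicity S))"

definition minimal_generating_set :: "nat set \<Rightarrow> nat set \<Rightarrow> bool" where
  "minimal_generating_set S X \<longleftrightarrow>
     add_submonoid hull X = S \<and> (\<forall>Y. Y \<subset> X \<longrightarrow> add_submonoid hull Y \<noteq> S)"

text \<open>Every numerical semigroup has exactly one minimal generating set, and it is finite, so
  the description below is well-defined on numerical semigroups.\<close>

definition embedding_dimension :: "nat set \<Rightarrow> nat" where
  "embedding_dimension S = card (THE X. minimal_generating_set S X)"

definition A_semigroup :: "nat set \<Rightarrow> bool" where
  "A_semigroup S \<longleftrightarrow> numerical_semigroup S \<and>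
     \<not> (\<exists>s. s \<in> S \<and> s + 1 \<in> S \<and> int s < frobenius S \<and> int (s + 1) < frobenius S)"

definition MED_semigroup :: "nat set \<Rightarrow> bool" where
  "MED_semigroup S \<longleftrightarrow> numerical_semigroup S \<and> embedding_dimension S = multiplicity S"

definition AMED :: "nat \<Rightarrow> nat \<Rightarrow> nat set set" where
  "AMED f m =
     {S. A_semigroup S \<and> MED_semigroup S \<and> frobenius S = int f \<and> multiplicity S = m}"

definition inclusion_minimum :: "nat set set \<Rightarrow> nat set \<Rightarrow> bool" where
  "inclusion_minimum R M \<longleftrightarrow> M \<in> R \<and> (\<forall>S\<in>R. M \<subseteq> S)"

definition ratio_covariety :: "nat set set \<Rightarrow> bool" where
  "ratio_covariety R \<longleftrightarrow>
     R \<noteq> {} \<and> (\<forall>S\<in>R. numerical_semigroup S) \<and>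
     (\<exists>M. inclusion_minimum R M \<and>
        (\<forall>S\<in>R. \<forall>T\<in>R. S \<inter> T \<in> R) \<and>
        (\<forall>S\<in>R - {M}. S - {ratio S} \<in> R))"

definition Delta :: "nat \<Rightarrow> nat \<Rightarrow> nat set" where
  "Delta f m = multiples m \<union> ({0} \<union> {f + 1..})"

end

theory Submission
  imports Defs
begin

text \<open>
  The embedding dimension is the only ingredient that cannot be read off elementwise, so it is
  eliminated at the start. The unique minimal generating set of a numerical semigroup \<open>S\<close> is its
  set of atoms (nonzero elements that are not sums of two nonzero elements), because the
  atoms generate \<open>S\<close> and every generating set has to contain each of them. Two atoms are never
  congruent modulo the multiplicity \<open>m\<close>: the larger one would be the smaller one plus a positive multiple of \<open>m\<close>.
  Hence there are \<open>m\<close> atoms exactly when each residue class contains one, and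
  \<open>MED_semigroup_iff\<close> shows that this happens exactly when \<open>x + y - m \<in> S\<close> for
  all nonzero \<open>x, y \<in> S\<close>.

  Membership in \<open>AMED f m\<close> thereby becomes a list of conditions on elements
  (\<open>mem_AMED_iff\<close>). Each of them is visibly inherited by intersections, and each of them holds
  for \<open>Delta f m\<close>, which any member contains because a member contains \<open>m\<close> and all numbers
  above \<open>f\<close>. For the removal of the ratio \<open>r\<close>, the point is that all elements of \<open>S\<close> below \<open>r\<close>
  are multiples of \<open>m\<close>. If \<open>r = x + y\<close> or \<open>r = x + y - m\<close> with nonzero \<open>x, y \<in> S\<close> other
  than \<open>r\<close>, then \<open>x, y < r\<close>, and \<open>r\<close> itself would be a multiple of \<open>m\<close>. Thus \<open>S - {r}\<close> keeps both
  closure properties, and it keeps the Frobenius number because \<open>r < f\<close> unless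
  \<open>S = Delta f m\<close>.
\<close>

section \<open>Atoms and minimal generating sets\<close>

definition atoms :: "nat set \<Rightarrow> nat set" where
  "atoms S = {a \<in> S. a \<noteq> 0 \<and> (\<forall>x\<in>S - {0}. \<forall>y\<in>S - {0}. a \<noteq> x + y)}"

lemma add_submonoid_hull: "add_submonoid (add_submonoid hull X)"
  by (rule hull_in) (auto simp: add_submonoid_def)

lemma add_submonoid_mult:
  assumes "add_submonoid S" "x \<in> S"
  shows "k * x \<in> S"
  using assms by (induction k) (auto simp: add_submonoid_def)

text \<open>An element that is not an atom splits into two smaller elements, and this descent has to
  end in atoms.\<close>

lemma hull_atoms:
  assumes "add_submonoid S"
  shows "add_submonoid hull atoms S = S"
proof
  show "add_submonoid hull atoms S \<subseteq> S"
    using assms by (intro hull_minimal) (auto simp: atoms_def)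
next
  note hull_closed = iffD1[OF add_submonoid_def add_submonoid_hull[of "atoms S"]]
  have "x \<in> add_submonoid hull atoms S" if "x \<in> S" for x
    using that
  proof (induction x rule: less_induct)
    case (less x)
    consider "x = 0" | "x \<in> atoms S"
      | y z where "y \<in> S - {0}" "z \<in> S - {0}" "x = y + z"
      using less.prems unfolding atoms_def by blast
    then show ?case
    proof cases
      case 1
      then show ?thesis
        using hull_closed by blast
    next
      case 2
      then show ?thesis by (rule hull_inc)
    next
      case 3
      then have "y \<in> add_submonoid hull atoms S" "z \<in> add_submonoid hull atoms S"
        using less.IH by auto
      then show ?thesis
        using hull_closed 3 by blast
    qed
  qed
  then show "S \<subseteq> add_submonoid hull atoms S" by blast
qed

text \<open>Removing an atom from \<open>S\<close> leaves a submonoid, so a set that omits the atom generates at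
  most that smaller submonoid.\<close>

lemma atoms_subset_generating_set:
  assumes "add_submonoid hull X = S"
  shows "atoms S \<subseteq> X"
proof
  fix a assume a: "a \<in> atoms S"
  have S: "add_submonoid S"
    using assms add_submonoid_hull by blast
  show "a \<in> X"
  proof (rule ccontr)
    assume "a \<notin> X"
    then have "X \<subseteq> S - {a}"
      using assms hull_subset[of X add_submonoid] by blast
    moreover have "add_submonoid (S - {a})"
      unfolding add_submonoid_def
    proof (intro conjI ballI)
      show "0 \<in> S - {a}"
        using S a by (auto simp: add_submonoid_def atoms_def)
      fix x y assume "x \<in> S - {a}" "y \<in> S - {a}"
      then show "x + y \<in> S - {a}"
        using S a by (cases "x = 0 \<or> y = 0") (auto simp: add_submonoid_def atoms_def)
    qed
    ultimately have "S \<subseteq> S - {a}"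
      using assms hull_minimal by metis
    then show False
      using a by (auto simp: atoms_def)
  qed
qed

lemma minimal_generating_set_iff_atoms:
  assumes "add_submonoid S"
  shows "minimal_generating_set S X \<longleftrightarrow> X = atoms S"
proof
  assume "minimal_generating_set S X"
  then have "add_submonoid hull X = S" "\<not> atoms S \<subset> X"
    using hull_atoms[OF assms] by (auto simp: minimal_generating_set_def)
  then show "X = atoms S"
    using atoms_subset_generating_set by blast
next
  assume "X = atoms S"
  moreover have "add_submonoid hull Y \<noteq> S" if "Y \<subset> atoms S" for Y
    using atoms_subset_generating_set[of Y S] that by blast
  ultimately show "minimal_generating_set S X"
    using hull_atoms[OF assms] by (simp add: minimal_generating_set_def)
qed

lemma embedding_dimension_eq_card_atoms:
  assumes "add_submonoid S"
  shows "embedding_dimension S = card (atoms S)"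
  using assms by (simp add: embedding_dimension_def minimal_generating_set_iff_atoms)

section \<open>Elementwise descriptions of the invariants\<close>

lemma cofinite_nat_iff: "finite (UNIV - S) \<longleftrightarrow> (\<exists>N. \<forall>n>N. n \<in> S)" for S :: "nat set"
  unfolding finite_nat_set_iff_bounded_le using not_le by blast

lemma multiplicity_eq_iff:
  assumes "numerical_semigroup S"
  shows "multiplicity S = m \<longleftrightarrow> m \<in> S \<and> m \<noteq> 0 \<and> (\<forall>x\<in>S - {0}. m \<le> x)"
proof -
  obtain N where "\<forall>n>N. n \<in> S"
    using assms cofinite_nat_iff by (auto simp: numerical_semigroup_def)
  then have "Suc N \<in> S - {0}" by simp
  then have "S - {0} \<noteq> {}" by blast
  then have "multiplicity S \<in> S - {0}"
    unfolding multiplicity_def by (rule Inf_nat_def1)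
  moreover have "\<forall>x\<in>S - {0}. multiplicity S \<le> x"
    unfolding multiplicity_def by (auto intro: wellorder_Inf_le1)
  ultimately show ?thesis
    by (metis DiffD1 DiffD2 DiffI insertI1 le_antisym singletonD)
qed

lemma frobenius_eq_iff:
  assumes "numerical_semigroup S"
  shows "frobenius S = int f \<longleftrightarrow> f \<notin> S \<and> (\<forall>n>f. n \<in> S)"
proof (cases "S = UNIV")
  case True
  then show ?thesis by (simp add: frobenius_def)
next
  case False
  then have "UNIV - S \<noteq> {}" "finite (UNIV - S)"
    using assms by (auto simp: numerical_semigroup_def)
  then have "Max (UNIV - S) = f \<longleftrightarrow> f \<in> UNIV - S \<and> (\<forall>n\<in>UNIV - S. n \<le> f)"
    by (intro Max_eq_iff) auto
  moreover have "(\<forall>n\<in>UNIV - S. n \<le> f) \<longleftrightarrow> (\<forall>n>f. n \<in> S)"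
    using not_le by blast
  ultimately show ?thesis
    using False by (simp add: frobenius_def)
qed

lemma add_multiple_of_cong:
  fixes a b m :: nat
  assumes "a mod m = b mod m" "a < b"
  shows "\<exists>k. b = a + Suc k * m"
proof -
  have "m dvd b - a"
    using assms by (metis less_imp_le mod_eq_dvd_iff_nat)
  then obtain j where j: "b - a = m * j" ..
  with assms(2) have "j \<noteq> 0" by (cases j) auto
  then obtain k where "j = Suc k" using not0_implies_Suc by blast
  with j assms(2) have "b = a + Suc k * m" by (simp add: mult.commute)
  then show ?thesis ..
qed

text \<open>The residues modulo \<open>m\<close> embed the atoms into \<open>{..<m}\<close>, so maximal embedding dimension
  means that each residue class contains an atom. Such an atom is then the least nonzero element
  of \<open>S\<close> in its class. A sum of two nonzero elements is not an atom, hence lies above the atom of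
  its class and stays in \<open>S\<close> after subtracting \<open>m\<close>. Conversely, the closure condition forbids the
  least nonzero element of a class to be such a sum.\<close>

lemma MED_semigroup_iff:
  assumes S: "numerical_semigroup S" and m: "multiplicity S = m"
  shows "MED_semigroup S \<longleftrightarrow> (\<forall>x\<in>S - {0}. \<forall>y\<in>S - {0}. x + y - m \<in> S)"
proof -
  have sub: "add_submonoid S"
    using S by (simp add: numerical_semigroup_def)
  have mS: "m \<in> S" "m \<noteq> 0" "\<And>x. x \<in> S \<Longrightarrow> x \<noteq> 0 \<Longrightarrow> m \<le> x"
    using multiplicity_eq_iff[OF S] m by auto
  have multS: "k * m \<in> S" for k
    using add_submonoid_mult[OF sub mS(1)] .
  have no_translate: False
    if "x \<in> S - {0}" "a \<in> atoms S" "x mod m = a mod m" "x < a" for x a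
  proof -
    from add_multiple_of_cong[OF that(3,4)] obtain k where "a = x + Suc k * m" ..
    then show False
      using that multS[of "Suc k"] mS(2) unfolding atoms_def by fastforce
  qed
  have inj: "inj_on (\<lambda>a. a mod m) (atoms S)"
  proof (rule inj_onI)
    fix a b assume ab: "a \<in> atoms S" "b \<in> atoms S" "a mod m = b mod m"
    then have "a \<in> S - {0}" "b \<in> S - {0}" by (auto simp: atoms_def)
    then show "a = b"
      using no_translate ab by (metis linorder_neqE_nat)
  qed
  have range: "(\<lambda>a. a mod m) ` atoms S \<subseteq> {..<m}"
    using mS(2) by auto
  have "MED_semigroup S \<longleftrightarrow> card (atoms S) = m"
    using S m embedding_dimension_eq_card_atoms[OF sub] by (simp add: MED_semigroup_def)
  also have "\<dots> \<longleftrightarrow> (\<lambda>a. a mod m) ` atoms S = {..<m}"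
    using card_image[OF inj] range by (metis card_lessThan card_subset_eq finite_lessThan)
  also have "\<dots> \<longleftrightarrow> (\<forall>x\<in>S - {0}. \<forall>y\<in>S - {0}. x + y - m \<in> S)"
  proof
    assume all: "(\<lambda>a. a mod m) ` atoms S = {..<m}"
    show "\<forall>x\<in>S - {0}. \<forall>y\<in>S - {0}. x + y - m \<in> S"
    proof (intro ballI)
      fix x y assume xy: "x \<in> S - {0}" "y \<in> S - {0}"
      have "(x + y) mod m \<in> (\<lambda>a. a mod m) ` atoms S"
        using all mS(2) by simp
      then obtain a where a: "a \<in> atoms S" "a mod m = (x + y) mod m"
        by auto
      have "x + y \<in> S - {0}"
        using xy sub by (auto simp: add_submonoid_def)
      then have "\<not> x + y < a"
        using no_translate a by metis
      moreover have "x + y \<noteq> a"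
        using a xy by (auto simp: atoms_def)
      ultimately obtain k where "x + y = a + Suc k * m"
        using add_multiple_of_cong[OF a(2)] by (metis linorder_neqE_nat)
      then have "x + y - m = a + k * m" by simp
      then show "x + y - m \<in> S"
        using a(1) multS sub by (auto simp: atoms_def add_submonoid_def)
    qed
  next
    assume closed: "\<forall>x\<in>S - {0}. \<forall>y\<in>S - {0}. x + y - m \<in> S"
    have "i \<in> (\<lambda>a. a mod m) ` atoms S" if "i < m" for i
    proof -
      let ?P = "\<lambda>w. w \<in> S - {0} \<and> w mod m = i"
      obtain N where N: "\<forall>n>N. n \<in> S"
        using S cofinite_nat_iff by (auto simp: numerical_semigroup_def)
      (* A multiple of m large enough to pass the bound N shifts i into S. *)
      have "N < i + Suc N * m"
        using mS(2) by (cases m) auto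
      then have "i + Suc N * m \<in> S - {0}"
        using N mS(2) by simp
      moreover have "(i + Suc N * m) mod m = i"
        using that by (simp only: mod_mult_self1 mod_less)
      ultimately have "\<exists>w. ?P w" by blast
      from this[unfolded exists_least_iff[of ?P]]
      obtain w where w: "?P w" "\<And>v. v < w \<Longrightarrow> \<not> ?P v"
        by blast
      have "w \<noteq> x + y" if xy: "x \<in> S - {0}" "y \<in> S - {0}" for x y
      proof
        assume eq: "w = x + y"
        have "m \<le> x" "m \<le> y" using mS(3) xy by auto
        then have "w - m < w" "w - m \<noteq> 0" "m \<le> w" using eq mS(2) by auto
        moreover have "w - m \<in> S" using closed xy eq by blast
        moreover have "(w - m) mod m = w mod m"
          using \<open>m \<le> w\<close> by (rule le_mod_geq[symmetric])
        ultimately show False using w(1) w(2)[of "w - m"] by simp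
      qed
      then have "w \<in> atoms S" using w(1) by (auto simp: atoms_def)
      then show ?thesis using w(1) by blast
    qed
    then show "(\<lambda>a. a mod m) ` atoms S = {..<m}"
      using range by blast
  qed
  finally show ?thesis .
qed

lemma mem_AMED_iff:
  "S \<in> AMED f m \<longleftrightarrow>
     add_submonoid S \<and> f \<notin> S \<and> (\<forall>n>f. n \<in> S) \<and>
     m \<in> S \<and> m \<noteq> 0 \<and> (\<forall>x\<in>S - {0}. m \<le> x) \<and>
     (\<forall>s\<in>S. s + 1 \<in> S \<longrightarrow> f \<le> s + 1) \<and>
     (\<forall>x\<in>S - {0}. \<forall>y\<in>S - {0}. x + y - m \<in> S)"
proof (cases "numerical_semigroup S")
  case False
  moreover have "numerical_semigroup S" if "add_submonoid S" "\<forall>n>f. n \<in> S"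
    using that cofinite_nat_iff by (auto simp: numerical_semigroup_def)
  ultimately show ?thesis
    by (auto simp: AMED_def A_semigroup_def)
next
  case True
  have "A_semigroup S \<longleftrightarrow> (\<forall>s\<in>S. s + 1 \<in> S \<longrightarrow> f \<le> s + 1)" if "frobenius S = int f"
    using True that by (auto simp: A_semigroup_def not_less)
  moreover have "add_submonoid S"
    using True by (simp add: numerical_semigroup_def)
  ultimately have "S \<in> AMED f m \<longleftrightarrow>
      add_submonoid S \<and> frobenius S = int f \<and> multiplicity S = m \<and>
      (\<forall>s\<in>S. s + 1 \<in> S \<longrightarrow> f \<le> s + 1) \<and>
      (\<forall>x\<in>S - {0}. \<forall>y\<in>S - {0}. x + y - m \<in> S)"
    using MED_semigroup_iff[OF True] unfolding AMED_def by blast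
  then show ?thesis
    unfolding frobenius_eq_iff[OF True] multiplicity_eq_iff[OF True] by blast
qed

lemma AMED_numerical_semigroup: "S \<in> AMED f m \<Longrightarrow> numerical_semigroup S"
  by (simp add: AMED_def A_semigroup_def)

section \<open>The covariety properties\<close>

lemma mem_multiples_iff: "x \<in> multiples m \<longleftrightarrow> m dvd x"
  by (auto simp: multiples_def dvd_def mult.commute)

lemma mem_Delta_iff: "x \<in> Delta f m \<longleftrightarrow> m dvd x \<or> f < x"
  by (auto simp: Delta_def mem_multiples_iff)

lemma Delta_mem_AMED:
  assumes "m > 0" "\<not> m dvd f" "m \<le> f + 1"
  shows "Delta f m \<in> AMED f m"
proof -
  have m1: "m \<noteq> 1" using assms(2) by auto
  have least: "m \<le> x" if "x \<in> Delta f m" "x \<noteq> 0" for x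
    using that assms(3) by (auto simp: mem_Delta_iff intro: dvd_imp_le)
  have "add_submonoid (Delta f m)"
    by (auto simp: add_submonoid_def mem_Delta_iff)
  moreover have "f \<le> s + 1" if "s \<in> Delta f m" "s + 1 \<in> Delta f m" for s
  proof (rule ccontr)
    assume "\<not> f \<le> s + 1"
    then have "m dvd s" "m dvd s + 1"
      using that by (auto simp: mem_Delta_iff)
    then have "m dvd 1" using dvd_add_right_iff by blast
    then show False using m1 by simp
  qed
  moreover have "x + y - m \<in> Delta f m"
    if "x \<in> Delta f m - {0}" "y \<in> Delta f m - {0}" for x y
  proof -
    have "m \<le> x" "m \<le> y" using that least by auto
    then show ?thesis
      using that by (auto simp: mem_Delta_iff)
  qed
  ultimately show ?thesis
    using assms least unfolding mem_AMED_iff by (auto simp: mem_Delta_iff)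
qed

lemma Delta_subset_of_mem_AMED:
  assumes "S \<in> AMED f m"
  shows "Delta f m \<subseteq> S"
proof
  fix x assume "x \<in> Delta f m"
  moreover have "k * m \<in> S" for k
    using assms add_submonoid_mult unfolding mem_AMED_iff by blast
  ultimately show "x \<in> S"
    using assms unfolding mem_AMED_iff mem_Delta_iff by (metis dvdE mult.commute)
qed

lemma AMED_Int:
  assumes "S \<in> AMED f m" "T \<in> AMED f m"
  shows "S \<inter> T \<in> AMED f m"
  using assms unfolding mem_AMED_iff add_submonoid_def by auto

text \<open>The facts \<open>sum_ne\<close> and \<open>diff_ne\<close> below say that neither closure condition ever needs \<open>r\<close>:
  it would have to arise from elements of \<open>S\<close> below \<open>r\<close>, which are all multiples of \<open>m\<close>. That
  \<open>S\<close> exceeds \<open>Delta f m\<close> serves to place \<open>r\<close> below \<open>f\<close>; a larger \<open>r\<close> would become a new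
  Frobenius number.\<close>

lemma AMED_remove_ratio:
  assumes S: "S \<in> AMED f m" and "S \<noteq> Delta f m"
  shows "S - {ratio S} \<in> AMED f m"
proof -
  define r where "r = ratio S"
  note conds = S[unfolded mem_AMED_iff]
  have "multiplicity S = m"
    using S by (simp add: AMED_def)
  then have r_eq: "r = Inf (S - multiples m)"
    by (simp add: r_def ratio_def)
  obtain x where x: "x \<in> S" "x \<notin> Delta f m"
    using assms Delta_subset_of_mem_AMED by blast
  then have x_in: "x \<in> S - multiples m"
    by (simp add: mem_Delta_iff mem_multiples_iff)
  then have "S - multiples m \<noteq> {}" by blast
  then have "r \<in> S - multiples m"
    unfolding r_eq by (rule Inf_nat_def1)
  then have r: "r \<in> S" "\<not> m dvd r"
    by (auto simp: mem_multiples_iff)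
  have "r \<le> x"
    unfolding r_eq using x_in by (rule wellorder_Inf_le1)
  moreover have "x \<le> f"
    using x by (simp add: mem_Delta_iff)
  ultimately have "r < f"
    using r(1) conds by (metis le_trans order_le_less)
  have below: "m dvd y" if "y \<in> S" "y < r" for y
  proof (rule ccontr)
    assume "\<not> m dvd y"
    then have "r \<le> y"
      unfolding r_eq using that(1) by (intro wellorder_Inf_le1) (auto simp: mem_multiples_iff)
    with that(2) show False by simp
  qed
  have sum_ne: "y + z \<noteq> r" if "y \<in> S - {r}" "z \<in> S - {r}" for y z
  proof
    assume eq: "y + z = r"
    with that have "y < r" "z < r" by auto
    then show False
      using below that eq r(2) dvd_add by blast
  qed
  have diff_ne: "y + z - m \<noteq> r" if "y \<in> S - {r} - {0}" "z \<in> S - {r} - {0}" for y z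
  proof
    assume eq: "y + z - m = r"
    (* Since m \<le> z, the equation gives y \<le> r, and y \<noteq> r makes this strict; likewise for z. *)
    have "m \<le> y" "m \<le> z" using that conds by auto
    with eq that have "y < r" "z < r" by auto
    then have "m dvd y + z - m"
      using below that by (intro dvd_diff_nat dvd_add) auto
    then show False using eq r(2) by simp
  qed
  have "add_submonoid (S - {r})"
    using conds sum_ne r(2) unfolding add_submonoid_def by auto
  moreover have "m \<noteq> r" using r(2) by auto
  ultimately have "S - {r} \<in> AMED f m"
    using conds diff_ne \<open>r < f\<close> unfolding mem_AMED_iff by auto
  then show ?thesis by (simp add: r_def)
qed

theorem corollary43:
  fixes f m :: nat
  assumes "f > 0" and "m > 0" and "\<not> m dvd f" and "m \<le> f + 1"
  shows "ratio_covariety (AMED f m) \<and> inclusion_minimum (AMED f m) (Delta f m)"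
proof
  show min: "inclusion_minimum (AMED f m) (Delta f m)"
    using Delta_mem_AMED[OF assms(2-4)] Delta_subset_of_mem_AMED
    by (simp add: inclusion_minimum_def)
  show "ratio_covariety (AMED f m)"
    unfolding ratio_covariety_def
  proof (intro conjI exI[of _ "Delta f m"])
    show "AMED f m \<noteq> {}"
      using min by (auto simp: inclusion_minimum_def)
  qed (use min AMED_numerical_semigroup AMED_Int AMED_remove_ratio in auto)
qed

end
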